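(* Let $\langle\phi,\vec a\rangle$ be a loop. If \[ [\![\vec x'=\vec a^n(\vec x)\mid\top\mid\phi(\vec x)]\!]_{\vec a}\leadsto^* [\![\psi(\vec y)\mid\check\phi(\vec x)\mid\top]\!]_{\vec a}, \] then $\psi$ approximates $\langle\phi,\vec a\rangle$. If \[ [\![\vec x'=\vec a^n(\vec x)\mid\top\mid\phi(\vec x)]\!]_{\vec a}\leadsto_e^* [\![\psi(\vec y)\mid\check\phi(\vec x)\mid\top]\!]_{\vec a}, \] then $\psi$ is equivalent to $\langle\phi,\vec a\rangle$.
   Context: Fix $d\ge 1$, integer variables $\vec x=(x_1,\dots,x_d)$, $\vec x'$, and $n$ ranging over $\mathbb N$; $\vec y=(\vec x,n,\vec x')$. A loop $\langle\phi,\vec a\rangle$ consists of a quantifier-free formula $\phi$ over atoms $p>0$ ($p$ an arithmetic expression over $\vec x$, integer semantics) and a map $\vec a:\mathbb Z^d\to\mathbb Z^d$ given by expressions over $\vec x$; $\vec a^m$ is $m$-fold application; $\top$ denotes truth. $\vec x\longrightarrow_{\langle\phi,\vec a\rangle}\vec x'$ iff $\phi(\vec x)\land\vec x'=\vec a(\vec x)$, and $\longrightarrow^m$ is its $m$-fold composition. A formula $\psi$ over $\vec y$ approximates $\langle\phi,\vec a\rangle$ if for all $\vec x,\vec x'\in\mathbb Z^d$, $n>0$, $\psi$ implies $\vec x\longrightarrow^n_{\langle\phi,\vec a\rangle}\vec x'$, and is equivalent to it if moreover the converse holds. A conditional acceleration technique is a partial function $\mathit{accel}$ from pairs (loop $\langle\chi,\vec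 a\rangle$, quantifier-free formula $\check\phi$ over $\vec x$) to formulas over $\vec y$; it is sound if for all arguments in its domain, all $\vec x,\vec x'$ and $n>0$, $\vec x\longrightarrow^n_{\langle\check\phi,\vec a\rangle}\vec x'\land\mathit{accel}(\langle\chi,\vec a\rangle,\check\phi)$ implies $\vec x\longrightarrow^n_{\langle\chi,\vec a\rangle}\vec x'$; it is exact if it is sound and $\vec x\longrightarrow^n_{\langle\chi\land\check\phi,\vec a\rangle}\vec x'$ implies $\mathit{accel}(\langle\chi,\vec a\rangle,\check\phi)$. Formulas are in CNF and identified with their sets of clauses. An acceleration problem is a tuple $[\![\psi\mid\check\phi\mid\hat\phi]\!]_{\vec a}$ with $\psi$ a formula over $\vec y$, $\check\phi,\hat\phi$ quantifier-free formulas over $\vec x$, and $\vec a:\mathbb Z^d\to\mathbb Z^d$. The relation $\leadsto$ is defined by: $[\![\psi_1\mid\check\phi\mid\hat\phi]\!]_{\vec a}\leadsto[\![\psi_1\cup\psi_2\mid\check\phi\cup\chi\mid\hat\phi\setminus\chi]\!]_{\vec a}$ whenever $\emptyset\ne\chi\subseteq\hat\phi$ (as sets of clauses) and $\mathit{accel}(\langle\chi,\vec a\rangle,\check\phi)=\psi_2$ for some sound conditional acceleration technique $\mathit{accel}$; such a step is a $\leadsto_e$-step if $\mathit{accel}$ is exact. $\leadsto^*$ and $\leadsto_e^*$ denote reflexive-transitive closures. *)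

theory Defs
  imports "HOL-Analysis.Finite_Cartesian_Product" "HOL-Library.FSet"
begin

section \<open>Expressions and formulas\<close>

datatype 'v aexp =
    Var 'v
  | Const int
  | Add "'v aexp" "'v aexp"
  | Sub "'v aexp" "'v aexp"
  | Mul "'v aexp" "'v aexp"
  | Div "'v aexp" "'v aexp"
  | Pow "'v aexp" "'v aexp"

text \<open>
  All operations are total on the integers: division rounds towards minus infinity,
  division by \<open>0\<close> yields \<open>0\<close>, and negative exponents are truncated to \<open>0\<close>.
\<close>

primrec aeval :: "('v \<Rightarrow> int) \<Rightarrow> 'v aexp \<Rightarrow> int" where
  "aeval \<sigma> (Var v) = \<sigma> v"
| "aeval \<sigma> (Const c) = c"
| "aeval \<sigma> (Add p q) = aeval \<sigma> p + aeval \<sigma> q"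
| "aeval \<sigma> (Sub p q) = aeval \<sigma> p - aeval \<sigma> q"
| "aeval \<sigma> (Mul p q) = aeval \<sigma> p * aeval \<sigma> q"
| "aeval \<sigma> (Div p q) = aeval \<sigma> p div aeval \<sigma> q"
| "aeval \<sigma> (Pow p q) = aeval \<sigma> p ^ nat (aeval \<sigma> q)"

text \<open>\<open>Pos p\<close> is the atom \<open>p > 0\<close>, and \<open>Neg p\<close> is its negation.\<close>

datatype 'v literal = Pos "'v aexp" | Neg "'v aexp"

primrec lit_holds :: "('v \<Rightarrow> int) \<Rightarrow> 'v literal \<Rightarrow> bool" where
  "lit_holds \<sigma> (Pos p) \<longleftrightarrow> aeval \<sigma> p > 0"
| "lit_holds \<sigma> (Neg p) \<longleftrightarrow> \<not> aeval \<sigma> p > 0"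

text \<open>
  A formula in CNF is the finite set of its clauses, and a clause is the finite set of its
  literals. Conjunction is thus \<open>|\<union>|\<close>, and truth is \<open>{||}\<close>.
\<close>

type_synonym 'v cnf = "'v literal fset fset"

definition sat :: "('v \<Rightarrow> int) \<Rightarrow> 'v cnf \<Rightarrow> bool" where
  "sat \<sigma> F \<longleftrightarrow> (\<forall>C |\<in>| F. \<exists>l |\<in>| C. lit_holds \<sigma> l)"


section \<open>Loops\<close>

text \<open>
  The program variables are indexed by the finite type \<open>'d\<close>, so that \<open>d = CARD('d) \<ge> 1\<close>.
\<close>

type_synonym 'd update = "'d \<Rightarrow> 'd aexp"
type_synonym 'd loop = "'d cnf \<times> 'd update"

definition apply_update :: "'d::finite update \<Rightarrow> int ^ 'd \<Rightarrow> int ^ 'd" where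
  "apply_update a x = (\<chi> i. aeval (($) x) (a i))"

definition holds_at :: "'d::finite cnf \<Rightarrow> int ^ 'd \<Rightarrow> bool" where
  "holds_at \<phi> x \<longleftrightarrow> sat (($) x) \<phi>"

definition loop_step :: "'d::finite loop \<Rightarrow> int ^ 'd \<Rightarrow> int ^ 'd \<Rightarrow> bool" where
  "loop_step L x x' \<longleftrightarrow> holds_at (fst L) x \<and> x' = apply_update (snd L) x"


section \<open>Formulas over \<open>(x, n, x')\<close>\<close>

datatype 'd yvar = Pre 'd | Count | Post 'd

fun yvar_val :: "int ^ 'd::finite \<Rightarrow> nat \<Rightarrow> int ^ 'd \<Rightarrow> 'd yvar \<Rightarrow> int" where
  "yvar_val x n x' (Pre i) = x $ i"
| "yvar_val x n x' Count = int n"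
| "yvar_val x n x' (Post i) = x' $ i"

text \<open>
  Formulas over \<open>(x, n, x')\<close> such as \<open>x' = a\<^sup>n(x)\<close> mention iterates of loop bodies.
  Besides the variables, the leaves of their expressions are therefore the terms
  \<open>Iter a e i\<close>, which stand for the component \<open>i\<close> of \<open>a\<^sup>e(x)\<close>, where \<open>e\<close> is an arithmetic
  expression over \<open>(x, n, x')\<close>, such as \<open>n\<close> or \<open>n - 1\<close>.
\<close>

datatype 'd yleaf = YVar "'d yvar" | Iter "'d update" "'d yvar aexp" 'd

fun yleaf_val :: "int ^ 'd::finite \<Rightarrow> nat \<Rightarrow> int ^ 'd \<Rightarrow> 'd yleaf \<Rightarrow> int" where
  "yleaf_val x n x' (YVar v) = yvar_val x n x' v"
| "yleaf_val x n x' (Iter a e i) =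
    ((apply_update a ^^ nat (aeval (yvar_val x n x') e)) x) $ i"

type_synonym 'd yformula = "'d yleaf cnf"

definition yholds_at :: "'d::finite yformula \<Rightarrow> int ^ 'd \<Rightarrow> nat \<Rightarrow> int ^ 'd \<Rightarrow> bool" where
  "yholds_at \<psi> x n x' \<longleftrightarrow> sat (yleaf_val x n x') \<psi>"

definition eq_cnf :: "'v aexp \<Rightarrow> 'v aexp \<Rightarrow> 'v cnf" where
  "eq_cnf p q = {| {| Neg (Sub p q) |}, {| Neg (Sub q p) |} |}"

text \<open>The formula \<open>x' = a\<^sup>n(x)\<close>.\<close>

definition iterate_formula :: "'d::finite update \<Rightarrow> 'd yformula" where
  "iterate_formula a =
    ffUnion ((\<lambda>i. eq_cnf (Var (YVar (Post i))) (Var (Iter a (Var Count) i))) |`| fUNIV)"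

lemma yholds_at_iterate_formula:
  "yholds_at (iterate_formula a) x n x' \<longleftrightarrow> x' = (apply_update a ^^ n) x"
proof -
  have "yholds_at (iterate_formula a) x n x' \<longleftrightarrow>
      (\<forall>i. x' $ i \<le> ((apply_update a ^^ n) x) $ i \<and> ((apply_update a ^^ n) x) $ i \<le> x' $ i)"
    by (auto simp: yholds_at_def sat_def iterate_formula_def eq_cnf_def ffUnion.rep_eq not_less)
  then show ?thesis
    by (auto simp: vec_eq_iff intro: antisym)
qed


section \<open>Approximation and equivalence\<close>

definition approximates :: "'d::finite yformula \<Rightarrow> 'd loop \<Rightarrow> bool" where
  "approximates \<psi> L \<longleftrightarrow>
    (\<forall>x x' n. n > 0 \<longrightarrow> yholds_at \<psi> x n x' \<longrightarrow> (loop_step L ^^ n) x x')"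

definition equivalent_to_loop :: "'d::finite yformula \<Rightarrow> 'd loop \<Rightarrow> bool" where
  "equivalent_to_loop \<psi> L \<longleftrightarrow>
    approximates \<psi> L \<and>
    (\<forall>x x' n. n > 0 \<longrightarrow> (loop_step L ^^ n) x x' \<longrightarrow> yholds_at \<psi> x n x')"


section \<open>Conditional acceleration techniques\<close>

type_synonym 'd cond_accel = "'d loop \<times> 'd cnf \<rightharpoonup> 'd yformula"

definition sound_accel :: "'d::finite cond_accel \<Rightarrow> bool" where
  "sound_accel accel \<longleftrightarrow>
    (\<forall>G a \<phi>c \<psi>. accel ((G, a), \<phi>c) = Some \<psi> \<longrightarrow>
      (\<forall>x x' n. n > 0 \<longrightarrow>
        (loop_step (\<phi>c, a) ^^ n) x x' \<and> yholds_at \<psi> x n x' \<longrightarrow>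
        (loop_step (G, a) ^^ n) x x'))"

definition exact_accel :: "'d::finite cond_accel \<Rightarrow> bool" where
  "exact_accel accel \<longleftrightarrow>
    sound_accel accel \<and>
    (\<forall>G a \<phi>c \<psi>. accel ((G, a), \<phi>c) = Some \<psi> \<longrightarrow>
      (\<forall>x x' n. n > 0 \<longrightarrow>
        (loop_step (G |\<union>| \<phi>c, a) ^^ n) x x' \<longrightarrow> yholds_at \<psi> x n x'))"


section \<open>The acceleration calculus\<close>

text \<open>\<open>Problem \<psi> \<phi>c \<phi>h a\<close>: result so far, processed guard, remaining guard, loop body.\<close>

datatype 'd problem = Problem "'d yformula" "'d cnf" "'d cnf" "'d update"

inductive calc_step :: "'d::finite problem \<Rightarrow> 'd problem \<Rightarrow> bool" (infix "\<leadsto>" 50) where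
  "\<lbrakk> G \<noteq> {||}; G |\<subseteq>| \<phi>h; sound_accel accel; accel ((G, a), \<phi>c) = Some \<psi>\<^sub>2 \<rbrakk> \<Longrightarrow>
    Problem \<psi>\<^sub>1 \<phi>c \<phi>h a \<leadsto> Problem (\<psi>\<^sub>1 |\<union>| \<psi>\<^sub>2) (\<phi>c |\<union>| G) (\<phi>h |-| G) a"

inductive exact_calc_step :: "'d::finite problem \<Rightarrow> 'd problem \<Rightarrow> bool" (infix "\<leadsto>\<^sub>e" 50) where
  "\<lbrakk> G \<noteq> {||}; G |\<subseteq>| \<phi>h; exact_accel accel; accel ((G, a), \<phi>c) = Some \<psi>\<^sub>2 \<rbrakk> \<Longrightarrow>
    Problem \<psi>\<^sub>1 \<phi>c \<phi>h a \<leadsto>\<^sub>e Problem (\<psi>\<^sub>1 |\<union>| \<psi>\<^sub>2) (\<phi>c |\<union>| G) (\<phi>h |-| G) a"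

end

theory Submission
  imports Defs
begin

text \<open>
  Each step preserves that the result so far approximates (for exact steps: is equivalent to)
  the loop guarded by the processed part \<open>\<phi>c\<close> of the guard, and that \<open>\<phi>c\<close> and the remaining
  part together make up \<open>\<phi>\<close>. Since loops are deterministic, running \<open>n\<close> times under a
  conjunction of guards means running \<open>n\<close> times under each of them, so soundness of a
  conditional technique extends the processed part.
\<close>

lemma holds_at_union: "holds_at (F |\<union>| G) x \<longleftrightarrow> holds_at F x \<and> holds_at G x"
  by (auto simp: holds_at_def sat_def)

lemma holds_at_empty [simp]: "holds_at {||} x"
  by (simp add: holds_at_def sat_def)

lemma yholds_at_union: "yholds_at (F |\<union>| G) x n x' \<longleftrightarrow> yholds_at F x n x' \<and> yholds_at G x n x'"
  by (auto simp: yholds_at_def sat_def)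

text \<open>Determinism forces the intermediate states to be the iterates of \<open>x\<close>. The
  guard is tested before each step, hence at iterates \<open>0\<close> to \<open>n - 1\<close> but
  not at \<open>x'\<close>.\<close>

lemma loop_step_pow_iff:
  "(loop_step (G, a) ^^ n) x x' \<longleftrightarrow>
    x' = (apply_update a ^^ n) x \<and> (\<forall>m<n. holds_at G ((apply_update a ^^ m) x))"
proof (induction n arbitrary: x')
  case 0
  then show ?case by auto
next
  case (Suc n)
  have "(loop_step (G, a) ^^ Suc n) x x' \<longleftrightarrow>
      (\<exists>y. (loop_step (G, a) ^^ n) x y \<and> holds_at G y \<and> x' = apply_update a y)"
    by (simp add: relcompp_apply loop_step_def[of _ _ x'])
  then show ?case
    by (auto simp: Suc.IH less_Suc_eq)
qed

lemma loop_step_pow_union: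
  "(loop_step (F |\<union>| G, a) ^^ n) x x' \<longleftrightarrow>
    (loop_step (F, a) ^^ n) x x' \<and> (loop_step (G, a) ^^ n) x x'"
  by (auto simp: loop_step_pow_iff holds_at_union)

lemma equivalent_iterate_formula: "equivalent_to_loop (iterate_formula a) ({||}, a)"
  by (simp add: equivalent_to_loop_def approximates_def loop_step_pow_iff
      yholds_at_iterate_formula)

text \<open>\<open>\<psi>\<^sub>1\<close> supplies the run under \<open>\<phi>c\<close> that
  soundness presupposes; \<open>\<psi>\<^sub>2\<close> then yields the run under \<open>G\<close>,
  and the two runs combine.\<close>

lemma approximates_union:
  assumes "approximates \<psi>\<^sub>1 (\<phi>c, a)" "sound_accel accel" "accel ((G, a), \<phi>c) = Some \<psi>\<^sub>2"
  shows "approximates (\<psi>\<^sub>1 |\<union>| \<psi>\<^sub>2) (\<phi>c |\<union>| G, a)"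
  using assms unfolding approximates_def sound_accel_def loop_step_pow_union yholds_at_union
  by blast

lemma equivalent_union:
  assumes equiv: "equivalent_to_loop \<psi>\<^sub>1 (\<phi>c, a)"
    and exact: "exact_accel accel" and accel: "accel ((G, a), \<phi>c) = Some \<psi>\<^sub>2"
  shows "equivalent_to_loop (\<psi>\<^sub>1 |\<union>| \<psi>\<^sub>2) (\<phi>c |\<union>| G, a)"
proof -
  have "approximates (\<psi>\<^sub>1 |\<union>| \<psi>\<^sub>2) (\<phi>c |\<union>| G, a)"
    using assms by (auto intro: approximates_union simp: equivalent_to_loop_def exact_accel_def)
  \<comment> \<open>A run under both guards contains one under \<open>\<phi>c\<close>, giving
    \<open>\<psi>\<^sub>1\<close>, and by exactness it gives \<open>\<psi>\<^sub>2\<close>.\<close>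
  moreover have "yholds_at (\<psi>\<^sub>1 |\<union>| \<psi>\<^sub>2) x n x'"
    if "n > 0" "(loop_step (\<phi>c |\<union>| G, a) ^^ n) x x'" for x n x'
    using that equiv exact accel
    unfolding equivalent_to_loop_def exact_accel_def loop_step_pow_union yholds_at_union
    by blast
  ultimately show ?thesis
    by (simp add: equivalent_to_loop_def)
qed

text \<open>The parameter \<open>R\<close> lets both calculi share one invariant.\<close>

fun invariant ::
    "('d::finite yformula \<Rightarrow> 'd loop \<Rightarrow> bool) \<Rightarrow> 'd cnf \<Rightarrow> 'd update \<Rightarrow> 'd problem \<Rightarrow> bool" where
  "invariant R \<phi> a (Problem \<psi> \<phi>c \<phi>h b) \<longleftrightarrow> b = a \<and> \<phi>c |\<union>| \<phi>h = \<phi> \<and> R \<psi> (\<phi>c, a)"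

text \<open>Clauses only move from the remaining to the processed part, so their union stays
  \<open>\<phi>\<close>.\<close>

lemma calc_step_invariant:
  assumes "p \<leadsto> q" "invariant approximates \<phi> a p"
  shows "invariant approximates \<phi> a q"
  using assms by cases (auto intro: approximates_union)

lemma exact_calc_step_invariant:
  assumes "p \<leadsto>\<^sub>e q" "invariant equivalent_to_loop \<phi> a p"
  shows "invariant equivalent_to_loop \<phi> a q"
  using assms by cases (auto intro: equivalent_union)

lemma calc_steps_invariant:
  assumes "(\<leadsto>)\<^sup>*\<^sup>* p q" "invariant approximates \<phi> a p"
  shows "invariant approximates \<phi> a q"
  using assms by induction (auto intro: calc_step_invariant)

lemma exact_calc_steps_invariant:
  assumes "(\<leadsto>\<^sub>e)\<^sup>*\<^sup>* p q" "invariant equivalent_to_loop \<phi> a p"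
  shows "invariant equivalent_to_loop \<phi> a q"
  using assms by induction (auto intro: exact_calc_step_invariant)

theorem theorem5:
  fixes \<phi> \<phi>c :: "'d::finite cnf" and a :: "'d update" and \<psi> :: "'d yformula"
  shows "((\<leadsto>)\<^sup>*\<^sup>* (Problem (iterate_formula a) {||} \<phi> a) (Problem \<psi> \<phi>c {||} a) \<longrightarrow>
            approximates \<psi> (\<phi>, a)) \<and>
         ((\<leadsto>\<^sub>e)\<^sup>*\<^sup>* (Problem (iterate_formula a) {||} \<phi> a) (Problem \<psi> \<phi>c {||} a) \<longrightarrow>
            equivalent_to_loop \<psi> (\<phi>, a))"
proof -
  have "invariant equivalent_to_loop \<phi> a (Problem (iterate_formula a) {||} \<phi> a)"
    by (simp add: equivalent_iterate_formula)
  moreover from this have "invariant approximates \<phi> a (Problem (iterate_formula a) {||} \<phi> a)"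
    by (simp add: equivalent_to_loop_def)
  \<comment> \<open>In the final problem the remaining part is empty, so the invariant forces
    \<open>\<phi>c = \<phi>\<close>.\<close>
  ultimately show ?thesis
    by (auto dest: calc_steps_invariant exact_calc_steps_invariant)
qed

end
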